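(* Let $X$ be a topological space equipped with a scaling $(T_t)_{t>0}$ and let $\mathcal{S}$ be an ideal on $X$. If $\mathcal{S}=\mathcal{S}_\tau$ for some finite-valued continuous modulus $\tau$ on $X$, then $\mathcal{S}$ satisfies Condition (B). Conversely, if the scaling is space-continuous and $\mathcal{S}$ satisfies Condition (B), then $\mathcal{S}=\mathcal{S}_\tau$ for some finite-valued continuous modulus $\tau$ on $X$.
   Context: The Baire $\sigma$-algebra of $X$ is the smallest $\sigma$-algebra making all continuous functions $X\to\mathbb{R}$ measurable. A scaling on $X$ is a family of maps $T_t:X\to X$, $t>0$, with $T_tT_sx=T_{ts}x$, $T_1x=x$, such that $(x,t)\mapsto T_tx$ is measurable from (Baire $\sigma$-algebra of $X$)$\otimes\mathcal{B}((0,\infty))$ to the Baire $\sigma$-algebra of $X$. It is space-continuous if $x\mapsto T_tx$ is continuous for each fixed $t>0$. Write $T_tA=\{T_tx: x\in A\}$. A set is functionally closed if it equals $f^{-1}(\{0\})$ for a continuous $f:X\to\mathbb{R}$; functionally open sets are complements of functionally closed sets. An ideal on $X$ is a family of subsets of $X$ closed under finite unions and under taking subsets. A countable base of an ideal $\mathcal{S}$ is a countable subfamily of $\mathcal{S}$ such that each element of $\mathcal{S}$ is a subset of some member of it. A semicone is a set $V\subset X$ with $T_tV\subset V$ for all $t\ge1$. A modulus is a Baire measurable function $\tau:X\to[0,\infty]$ with $\tau(T_tx)=t\tau(x)$ for all $t>0$, $x\in X$. It generates the ideal $\mathcal{S}_\tau=\{A\subset X:\inf_{x\in A}\tau(x)>0\}$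 (with $\inf\emptyset=\infty$). Condition (B) on $\mathcal{S}$: $\mathcal{S}$ has a countable base of the form $(T_{n^{-1}}V)_{n\in\mathbb{N}}$, where $V$ is a functionally open semicone such that $\bigcap_{t>1}T_tV=\emptyset$, and there exists a functionally closed set $F$ such that $V\subset F\subset T_sV$ for every $s\in(0,1)$. *)

theory Defs
  imports "HOL-Analysis.Analysis"
begin

text \<open>A topological space is a value of type \<^typ>\<open>'a topology\<close> with carrier \<^term>\<open>topspace X\<close>,
  so that the empty space and subspaces are covered. A family of maps \<open>T\<close> indexed by \<open>t > 0\<close>
  is a function on all reals; its values at \<open>t \<le> 0\<close> or outside the carrier are never used.\<close>

definition baire :: "'a topology \<Rightarrow> 'a measure" where
  "baire X = sigma (topspace X)
     {f -` B \<inter> topspace X | f B. continuous_map X euclideanreal f \<and> B \<in> sets borel}"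

lemma space_baire [simp]: "space (baire X) = topspace X"
  unfolding baire_def by (rule space_measure_of) blast

lemma continuous_map_measurable_baire:
  assumes "continuous_map X euclideanreal f"
  shows "f \<in> borel_measurable (baire X)"
proof (rule measurableI)
  fix B :: "real set"
  assume "B \<in> sets borel"
  then have "f -` B \<inter> topspace X \<in>
      {f -` B \<inter> topspace X | f B. continuous_map X euclideanreal f \<and> B \<in> sets borel}"
    using assms by blast
  then show "f -` B \<inter> space (baire X) \<in> sets (baire X)"
    unfolding space_baire unfolding baire_def by (rule in_measure_of[rotated]) blast
qed simp

lemma sets_baire_least:
  assumes "space M = topspace X"
    and "\<And>f. continuous_map X euclideanreal f \<Longrightarrow> f \<in> borel_measurable M"
  shows "sets (baire X) \<subseteq> sets M"
proof -
  let ?G = "{f -` B \<inter> topspace X | f B. continuous_map X euclideanreal f \<and> B \<in> sets borel}"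
  have "?G \<subseteq> sets M"
    using measurable_sets[OF assms(2)] assms(1) by fastforce
  then have "sigma_sets (space M) ?G \<subseteq> sets M"
    by (rule sets.sigma_sets_subset)
  moreover have "sets (baire X) = sigma_sets (topspace X) ?G"
    unfolding baire_def by (rule sets_measure_of) blast
  ultimately show ?thesis
    using assms(1) by simp
qed

definition scaling :: "'a topology \<Rightarrow> (real \<Rightarrow> 'a \<Rightarrow> 'a) \<Rightarrow> bool" where
  "scaling X T \<longleftrightarrow>
     (\<forall>t>0. \<forall>x\<in>topspace X. T t x \<in> topspace X) \<and>
     (\<forall>t>0. \<forall>s>0. \<forall>x\<in>topspace X. T t (T s x) = T (t * s) x) \<and>
     (\<forall>x\<in>topspace X. T 1 x = x) \<and>
     (\<lambda>(x, t). T t x) \<in> baire X \<Otimes>\<^sub>M restrict_space borel {0<..} \<rightarrow>\<^sub>M baire X"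

definition space_continuous :: "'a topology \<Rightarrow> (real \<Rightarrow> 'a \<Rightarrow> 'a) \<Rightarrow> bool" where
  "space_continuous X T \<longleftrightarrow> (\<forall>t>0. continuous_map X X (T t))"

definition functionally_closed :: "'a topology \<Rightarrow> 'a set \<Rightarrow> bool" where
  "functionally_closed X F \<longleftrightarrow>
     (\<exists>f. continuous_map X euclideanreal f \<and> F = {x \<in> topspace X. f x = 0})"

definition functionally_open :: "'a topology \<Rightarrow> 'a set \<Rightarrow> bool" where
  "functionally_open X U \<longleftrightarrow> (\<exists>F. functionally_closed X F \<and> U = topspace X - F)"

text \<open>Closure under binary unions only: the family is not required to be nonempty.\<close>

definition ideal_on :: "'a topology \<Rightarrow> 'a set set \<Rightarrow> bool" where
  "ideal_on X S \<longleftrightarrow>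
     S \<subseteq> Pow (topspace X) \<and>
     (\<forall>A\<in>S. \<forall>B\<in>S. A \<union> B \<in> S) \<and>
     (\<forall>A\<in>S. \<forall>B. B \<subseteq> A \<longrightarrow> B \<in> S)"

definition countable_base :: "'a set set \<Rightarrow> 'a set set \<Rightarrow> bool" where
  "countable_base S \<B> \<longleftrightarrow> countable \<B> \<and> \<B> \<subseteq> S \<and> (\<forall>A\<in>S. \<exists>B\<in>\<B>. A \<subseteq> B)"

definition semicone :: "'a topology \<Rightarrow> (real \<Rightarrow> 'a \<Rightarrow> 'a) \<Rightarrow> 'a set \<Rightarrow> bool" where
  "semicone X T V \<longleftrightarrow> V \<subseteq> topspace X \<and> (\<forall>t\<ge>1. T t ` V \<subseteq> V)"

definition modulus :: "'a topology \<Rightarrow> (real \<Rightarrow> 'a \<Rightarrow> 'a) \<Rightarrow> ('a \<Rightarrow> ennreal) \<Rightarrow> bool" where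
  "modulus X T \<tau> \<longleftrightarrow>
     \<tau> \<in> borel_measurable (baire X) \<and>
     (\<forall>t>0. \<forall>x\<in>topspace X. \<tau> (T t x) = ennreal t * \<tau> x)"

text \<open>The infimum is taken in \<^typ>\<open>ennreal\<close>, where the empty infimum is \<open>\<infinity>\<close>.\<close>

definition modulus_ideal :: "'a topology \<Rightarrow> ('a \<Rightarrow> ennreal) \<Rightarrow> 'a set set" where
  "modulus_ideal X \<tau> = {A. A \<subseteq> topspace X \<and> (INF x\<in>A. \<tau> x) > 0}"

definition finite_continuous_modulus ::
    "'a topology \<Rightarrow> (real \<Rightarrow> 'a \<Rightarrow> 'a) \<Rightarrow> ('a \<Rightarrow> ennreal) \<Rightarrow> bool" where
  "finite_continuous_modulus X T \<tau> \<longleftrightarrow>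
     modulus X T \<tau> \<and> (\<forall>x\<in>topspace X. \<tau> x < \<infinity>) \<and> continuous_map X euclidean \<tau>"

definition condition_B :: "'a topology \<Rightarrow> (real \<Rightarrow> 'a \<Rightarrow> 'a) \<Rightarrow> 'a set set \<Rightarrow> bool" where
  "condition_B X T S \<longleftrightarrow>
     (\<exists>V. functionally_open X V \<and> semicone X T V \<and>
          countable_base S ((\<lambda>n::nat. T (1 / real n) ` V) ` {1..}) \<and>
          (\<Inter>t\<in>{1<..}. T t ` V) = {} \<and>
          (\<exists>F. functionally_closed X F \<and> V \<subseteq> F \<and> (\<forall>s\<in>{0<..<1}. F \<subseteq> T s ` V)))"

end

theory Submission
  imports Defs
begin

text \<open>The correspondence is the one between a homogeneous function and its unit
  superlevel set. Given \<open>\<tau>\<close>, the set \<open>V = {\<tau> > 1}\<close> satisfies \<open>T\<^sub>t V = {\<tau> > t}\<close>, so the sets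
  \<open>T\<^bsub>1/n\<^esub> V\<close> are a base of the ideal, the intersection of the \<open>T\<^sub>t V\<close> is empty because
  \<open>\<tau>\<close> is finite, and \<open>F = {\<tau> \<ge> 1}\<close> lies between \<open>V\<close> and each \<open>T\<^sub>s V\<close> with \<open>s < 1\<close>.

  Conversely, \<open>\<tau>\<close> is recovered from \<open>V\<close> as a gauge, \<open>\<tau> x = sup {t > 0. x \<in> T\<^sub>t V}\<close>. A semicone
  makes \<open>T\<^sub>t V\<close> decreasing in \<open>t\<close>; hence \<open>{\<tau> > a}\<close> is the union of the \<open>T\<^sub>t V\<close> over \<open>t > a\<close>, which
  gives lower semicontinuity since \<open>V\<close> is open. The set \<open>F\<close> provides upper semicontinuity:
  interleaving \<open>T\<^sub>t V \<subseteq> T\<^sub>t F \<subseteq> T\<^sub>r V\<close> for \<open>r < t\<close> shows that \<open>{\<tau> < a}\<close> is also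
  the union of the complements of the closed sets \<open>T\<^sub>t F\<close> over \<open>0 < t < a\<close>. Space-continuity enters
  because \<open>T\<^sub>t A\<close> is the preimage of \<open>A\<close> under the continuous map \<open>T\<^bsub>1/t\<^esub>\<close>.\<close>

section \<open>Images under a scaling\<close>

lemma scaling_closed: "scaling X T \<Longrightarrow> t > 0 \<Longrightarrow> x \<in> topspace X \<Longrightarrow> T t x \<in> topspace X"
  by (auto simp: scaling_def)

lemma scaling_mult:
  "scaling X T \<Longrightarrow> t > 0 \<Longrightarrow> s > 0 \<Longrightarrow> x \<in> topspace X \<Longrightarrow> T t (T s x) = T (t * s) x"
  by (auto simp: scaling_def)

lemma scaling_one: "scaling X T \<Longrightarrow> x \<in> topspace X \<Longrightarrow> T 1 x = x"
  by (auto simp: scaling_def)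

text \<open>Each \<open>T\<^sub>t\<close> is a bijection of the space with inverse \<open>T\<^bsub>1/t\<^esub>\<close>; this turns every question
  about images into one about preimages.\<close>

lemma scaling_image_eq_vimage:
  assumes "scaling X T" "t > 0" "A \<subseteq> topspace X"
  shows "T t ` A = {x \<in> topspace X. T (1 / t) x \<in> A}"
proof (intro set_eqI iffI)
  fix y assume "y \<in> T t ` A"
  then obtain x where "x \<in> A" "y = T t x" by blast
  then show "y \<in> {x \<in> topspace X. T (1 / t) x \<in> A}"
    using assms scaling_closed[of X T t x] scaling_mult[of X T "1 / t" t x] scaling_one[of X T x]
    by auto
next
  fix y assume y: "y \<in> {x \<in> topspace X. T (1 / t) x \<in> A}"
  then have "y = T t (T (1 / t) y)"
    using assms scaling_mult[of X T t "1 / t" y] scaling_one[of X T y] by auto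
  with y show "y \<in> T t ` A" by blast
qed

lemma scaling_image_comp:
  assumes "scaling X T" "t > 0" "s > 0" "A \<subseteq> topspace X"
  shows "T t ` T s ` A = T (t * s) ` A"
  using assms scaling_mult[of X T t s] by (force simp: image_image intro!: image_cong)

lemma mem_scaling_image_scaled_iff:
  assumes "scaling X T" "t > 0" "s > 0" "A \<subseteq> topspace X" "x \<in> topspace X"
  shows "T s x \<in> T t ` A \<longleftrightarrow> x \<in> T (t / s) ` A"
  using assms scaling_closed[of X T s x] scaling_mult[of X T "1 / t" s x]
  by (simp add: scaling_image_eq_vimage)

lemma semicone_image_antimono:
  assumes "scaling X T" "semicone X T V" "0 < s" "s \<le> t"
  shows "T t ` V \<subseteq> T s ` V"
proof -
  have "V \<subseteq> topspace X" "T (t / s) ` V \<subseteq> V"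
    using assms by (auto simp: semicone_def)
  then have "T s ` T (t / s) ` V \<subseteq> T s ` V" by blast
  with \<open>V \<subseteq> topspace X\<close> show ?thesis
    using assms scaling_image_comp[of X T s "t / s" V] by simp
qed

lemma openin_scaling_image:
  assumes "scaling X T" "space_continuous X T" "t > 0" "openin X A"
  shows "openin X (T t ` A)"
proof -
  have "continuous_map X X (T (1 / t))"
    using assms by (auto simp: space_continuous_def)
  from openin_continuous_map_preimage[OF this \<open>openin X A\<close>] show ?thesis
    using assms by (simp add: scaling_image_eq_vimage openin_subset)
qed

lemma closedin_scaling_image:
  assumes "scaling X T" "space_continuous X T" "t > 0" "closedin X A"
  shows "closedin X (T t ` A)"
proof -
  have "continuous_map X X (T (1 / t))"
    using assms by (auto simp: space_continuous_def)
  from closedin_continuous_map_preimage[OF this \<open>closedin X A\<close>] show ?thesis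
    using assms by (simp add: scaling_image_eq_vimage closedin_subset)
qed

section \<open>Functionally closed and open sets\<close>

lemma functionally_closed_ge:
  assumes "continuous_map X euclideanreal f"
  shows "functionally_closed X {x \<in> topspace X. c \<le> f x}"
  unfolding functionally_closed_def
proof (intro exI conjI)
  show "continuous_map X euclideanreal (\<lambda>x. max 0 (c - f x))"
    by (intro continuous_intros assms)
qed auto

lemma functionally_open_gt:
  assumes "continuous_map X euclideanreal f"
  shows "functionally_open X {x \<in> topspace X. c < f x}"
  unfolding functionally_open_def
proof (intro exI conjI)
  have "continuous_map X euclideanreal (\<lambda>x. - f x)"
    by (intro continuous_intros assms)
  from functionally_closed_ge[OF this, of "- c"]
  show "functionally_closed X {x \<in> topspace X. f x \<le> c}" by simp
qed auto

lemma functionally_closed_imp_closedin: "functionally_closed X F \<Longrightarrow> closedin X F"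
  using closedin_continuous_map_preimage[of X euclideanreal _ "{0}"]
  by (auto simp: functionally_closed_def)

lemma functionally_open_imp_openin: "functionally_open X U \<Longrightarrow> openin X U"
  by (auto simp: functionally_open_def intro: functionally_closed_imp_closedin)

section \<open>Finite continuous moduli\<close>

lemma continuous_map_enn2real:
  assumes "continuous_map X euclidean \<tau>" "\<And>x. x \<in> topspace X \<Longrightarrow> \<tau> x < \<infinity>"
  shows "continuous_map X euclideanreal (\<lambda>x. enn2real (\<tau> x))"
proof -
  have "continuous_map (top_of_set {..<\<infinity>}) euclideanreal enn2real"
    by (auto simp: continuous_on_eq_continuous_within continuous_within intro!: tendsto_enn2real)
  moreover have "continuous_map X (top_of_set {..<\<infinity>}) \<tau>"
    using assms by (auto simp: continuous_map_in_subtopology)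
  ultimately show ?thesis
    using continuous_map_compose[of X _ \<tau> _ enn2real] by (simp add: o_def)
qed

lemma continuous_map_ennreal:
  assumes "continuous_map X euclideanreal g"
  shows "continuous_map X euclidean (\<lambda>x. ennreal (g x))"
proof -
  have "continuous_map euclideanreal euclidean ennreal"
    by (auto intro!: continuous_on_ennreal continuous_on_id)
  from continuous_map_compose[OF assms this] show ?thesis
    by (simp only: o_def)
qed

text \<open>By homogeneity all superlevel sets at positive levels are dilates of one of them.\<close>

lemma scaling_image_superlevel:
  assumes "scaling X T" "modulus X T \<tau>" "t > 0"
  shows "T t ` {x \<in> topspace X. 1 < \<tau> x} = {x \<in> topspace X. ennreal t < \<tau> x}"
proof -
  have "1 < \<tau> (T (1 / t) x) \<longleftrightarrow> ennreal t < \<tau> x" if x: "x \<in> topspace X" for x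
  proof -
    have "\<tau> x = ennreal t * \<tau> (T (1 / t) x)"
    proof -
      have "T (1 / t) x \<in> topspace X" "T t (T (1 / t) x) = x"
        using assms x scaling_closed[of X T "1 / t" x] scaling_mult[of X T t "1 / t" x]
          scaling_one[of X T x] by auto
      with assms show ?thesis unfolding modulus_def by metis
    qed
    moreover have "ennreal t < ennreal t * u \<longleftrightarrow> 1 < u" for u
      using \<open>t > 0\<close> by (cases u) (auto simp: ennreal_mult[symmetric] ennreal_less_iff ennreal_mult_top)
    ultimately show ?thesis by simp
  qed
  then show ?thesis
    using assms by (auto simp: scaling_image_eq_vimage scaling_closed)
qed

text \<open>This passes from a positive infimum, which carries no scale, to a member of the countable
  base.\<close>

lemma positive_ennreal_gt_inverse_nat:
  assumes "(c :: ennreal) > 0"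
  obtains n :: nat where "n \<ge> 1" "ennreal (1 / real n) < c"
proof -
  obtain r where r: "0 < r" "ennreal r \<le> c"
  proof (cases c)
    case (real r)
    with assms that[of r] show ?thesis by simp
  qed (use that[of 1] in simp)
  obtain n where "inverse (real (Suc n)) < r" using reals_Archimedean r(1) by blast
  then have "ennreal (1 / real (Suc n)) < ennreal r"
    by (simp add: ennreal_less_iff inverse_eq_divide)
  with r have "ennreal (1 / real (Suc n)) < c" by (blast intro: less_le_trans)
  then show ?thesis using that[of "Suc n"] by simp
qed

theorem condition_B_modulus_ideal:
  assumes sc: "scaling X T" and \<tau>: "finite_continuous_modulus X T \<tau>"
  shows "condition_B X T (modulus_ideal X \<tau>)"
proof -
  define V where "V = {x \<in> topspace X. 1 < \<tau> x}"
  define F where "F = {x \<in> topspace X. 1 \<le> \<tau> x}"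
  have fin: "\<tau> x < \<infinity>" if "x \<in> topspace X" for x
    using \<tau> that by (auto simp: finite_continuous_modulus_def)
  have cont: "continuous_map X euclideanreal (\<lambda>x. enn2real (\<tau> x))"
    using \<tau> fin by (auto simp: finite_continuous_modulus_def intro!: continuous_map_enn2real)
  have img: "T t ` V = {x \<in> topspace X. ennreal t < \<tau> x}" if "t > 0" for t
    unfolding V_def using sc \<tau> that
    by (intro scaling_image_superlevel) (auto simp: finite_continuous_modulus_def)
  have real_eq: "ennreal (enn2real (\<tau> x)) = \<tau> x" if "x \<in> topspace X" for x
    using fin[OF that] by simp
  have "1 < \<tau> x \<longleftrightarrow> 1 < enn2real (\<tau> x)" "1 \<le> \<tau> x \<longleftrightarrow> 1 \<le> enn2real (\<tau> x)"
    if "x \<in> topspace X" for x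
    using real_eq[OF that]
    by (metis ennreal_1 ennreal_less_iff zero_le_one, metis ennreal_1 ennreal_le_iff enn2real_nonneg)
  then have "V = {x \<in> topspace X. 1 < enn2real (\<tau> x)}" "F = {x \<in> topspace X. 1 \<le> enn2real (\<tau> x)}"
    by (auto simp: V_def F_def)
  then have "functionally_open X V" "functionally_closed X F"
    using functionally_open_gt[OF cont] functionally_closed_ge[OF cont] by simp_all
  moreover have "semicone X T V"
    unfolding semicone_def
  proof (intro conjI allI impI)
    fix t :: real assume "1 \<le> t"
    then have "1 \<le> ennreal t" by simp
    from le_less_trans[OF this] show "T t ` V \<subseteq> V"
      using img[of t] \<open>1 \<le> t\<close> by (auto simp: V_def)
  qed (auto simp: V_def)
  moreover have "countable_base (modulus_ideal X \<tau>) ((\<lambda>n::nat. T (1 / real n) ` V) ` {1..})"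
    unfolding countable_base_def
  proof (intro conjI ballI)
    show "(\<lambda>n::nat. T (1 / real n) ` V) ` {1..} \<subseteq> modulus_ideal X \<tau>"
    proof (rule image_subsetI)
      fix n :: nat assume n: "n \<in> {1..}"
      then have le: "ennreal (1 / real n) \<le> (INF x\<in>T (1 / real n) ` V. \<tau> x)"
        using img[of "1 / real n"] by (auto intro!: INF_greatest)
      have "0 < ennreal (1 / real n)" using n by simp
      also note le
      finally have "0 < (INF x\<in>T (1 / real n) ` V. \<tau> x)" .
      then show "T (1 / real n) ` V \<in> modulus_ideal X \<tau>"
        using n img[of "1 / real n"] by (simp add: modulus_ideal_def)
    qed
  next
    fix A assume A: "A \<in> modulus_ideal X \<tau>"
    then obtain n :: nat where n: "n \<ge> 1" "ennreal (1 / real n) < (INF x\<in>A. \<tau> x)"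
      using positive_ennreal_gt_inverse_nat by (auto simp: modulus_ideal_def)
    then have "ennreal (1 / real n) < \<tau> x" if "x \<in> A" for x
      using that by (meson INF_lower less_le_trans)
    then have "A \<subseteq> T (1 / real n) ` V"
      using A n img[of "1 / real n"] by (auto simp: modulus_ideal_def)
    with n show "\<exists>B\<in>(\<lambda>n::nat. T (1 / real n) ` V) ` {1..}. A \<subseteq> B" by auto
  qed auto
  moreover have "(\<Inter>t\<in>{1<..}. T t ` V) = {}"
  proof (intro equals0I)
    fix x assume x: "x \<in> (\<Inter>t\<in>{1<..}. T t ` V)"
    define t where "t = enn2real (\<tau> x) + 2"
    have "1 < t" unfolding t_def using enn2real_nonneg[of "\<tau> x"] by linarith
    then have "x \<in> topspace X" "ennreal t < \<tau> x" using x img[of t] by auto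
    moreover have "ennreal (enn2real (\<tau> x)) \<le> ennreal t" by (intro ennreal_leI) (simp add: t_def)
    ultimately show False using real_eq[of x] by simp
  qed
  moreover have "V \<subseteq> F" by (auto simp: V_def F_def)
  moreover have "F \<subseteq> T s ` V" if "s \<in> {0<..<1}" for s
  proof -
    have "ennreal s < 1" using that by simp
    from less_le_trans[OF this] show ?thesis
      using that img[of s] by (auto simp: F_def)
  qed
  ultimately show ?thesis
    unfolding condition_B_def by blast
qed

section \<open>The gauge of a semicone\<close>

text \<open>The analogue of the Minkowski functional: here \<open>V\<close> plays the part of the complement of a ball,
  so a supremum replaces the usual infimum. With values in \<^typ>\<open>ennreal\<close> the supremum of the
  empty set is \<open>0\<close>, which is the right value at points outside every \<open>T\<^sub>t V\<close>.\<close>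

definition gauge_modulus :: "(real \<Rightarrow> 'a \<Rightarrow> 'a) \<Rightarrow> 'a set \<Rightarrow> 'a \<Rightarrow> ennreal" where
  "gauge_modulus T V x = (SUP t\<in>{t. 0 < t \<and> x \<in> T t ` V}. ennreal t)"

lemma less_gauge_modulus_iff:
  assumes "0 \<le> a"
  shows "ennreal a < gauge_modulus T V x \<longleftrightarrow> (\<exists>t>a. x \<in> T t ` V)"
  using assms by (auto simp: gauge_modulus_def less_SUP_iff ennreal_less_iff intro: le_less_trans)

lemma gauge_modulus_le:
  assumes "scaling X T" "semicone X T V" "0 < t" "x \<notin> T t ` V"
  shows "gauge_modulus T V x \<le> ennreal t"
  using assms semicone_image_antimono[of X T V t]
  by (meson less_gauge_modulus_iff less_imp_le not_le subsetD)

lemma le_gauge_modulus: "0 < t \<Longrightarrow> x \<in> T t ` V \<Longrightarrow> ennreal t \<le> gauge_modulus T V x"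
  by (auto simp: gauge_modulus_def intro: SUP_upper)

text \<open>Homogeneity: the index sets of the two suprema differ by the dilation \<open>t \<mapsto> s t\<close>.\<close>

lemma gauge_modulus_scaled:
  assumes "scaling X T" "V \<subseteq> topspace X" "s > 0" "x \<in> topspace X"
  shows "gauge_modulus T V (T s x) = ennreal s * gauge_modulus T V x"
proof -
  have "{t. 0 < t \<and> T s x \<in> T t ` V} = (*) s ` {t. 0 < t \<and> x \<in> T t ` V}" (is "?L = ?R")
  proof (intro set_eqI iffI)
    fix t assume "t \<in> ?L"
    then have "t / s \<in> {t. 0 < t \<and> x \<in> T t ` V}" "t = s * (t / s)"
      using assms mem_scaling_image_scaled_iff[of X T t s V x] by auto
    then show "t \<in> ?R" by blast
  next
    fix t assume "t \<in> ?R"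
    then obtain r where "t = s * r" "0 < r" "x \<in> T r ` V" by auto
    then show "t \<in> ?L"
      using assms mem_scaling_image_scaled_iff[of X T t s V x] by auto
  qed
  then have "gauge_modulus T V (T s x) = (SUP t\<in>{t. 0 < t \<and> x \<in> T t ` V}. ennreal (s * t))"
    by (simp add: gauge_modulus_def image_image)
  also have "\<dots> = (SUP t\<in>{t. 0 < t \<and> x \<in> T t ` V}. ennreal s * ennreal t)"
    using \<open>s > 0\<close> by (intro SUP_cong) (auto simp: ennreal_mult)
  finally show ?thesis by (simp add: gauge_modulus_def SUP_mult_left_ennreal)
qed

text \<open>The closed set \<open>F\<close> squeezed between \<open>V\<close> and its enlargements makes strict sublevel sets
  unions of complements of dilates of \<open>F\<close>, which are open once the scaling is space-continuous.\<close>

lemma gauge_modulus_less_iff: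
  assumes sc: "scaling X T" and V: "semicone X T V"
    and F: "F \<subseteq> topspace X" "V \<subseteq> F" "\<And>s. s \<in> {0<..<1} \<Longrightarrow> F \<subseteq> T s ` V"
    and "0 < a"
  shows "gauge_modulus T V x < ennreal a \<longleftrightarrow> (\<exists>t\<in>{0<..<a}. x \<notin> T t ` F)"
proof
  assume "gauge_modulus T V x < ennreal a"
  then obtain g where g: "gauge_modulus T V x = ennreal g" "0 \<le> g" "g < a"
    by (cases "gauge_modulus T V x") (auto simp: ennreal_less_iff)
  obtain r where r: "g < r" "r < a" using dense g by blast
  with g have "0 < r" by simp
  \<comment> \<open>Any \<open>t\<close> strictly between \<open>r\<close> and \<open>a\<close> works, since then \<open>T\<^sub>t F \<subseteq> T\<^sub>r V\<close>.\<close>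
  obtain t where t: "r < t" "t < a" using dense r by blast
  have "F \<subseteq> T (r / t) ` V" using F(3) t \<open>0 < r\<close> by auto
  then have "T t ` F \<subseteq> T t ` T (r / t) ` V" by blast
  also have "\<dots> = T r ` V"
    using sc V t \<open>0 < r\<close> scaling_image_comp[of X T t "r / t" V] by (auto simp: semicone_def)
  finally have "x \<notin> T t ` F"
    using le_gauge_modulus[of r x T V] r g \<open>0 < r\<close> by auto
  then show "\<exists>t\<in>{0<..<a}. x \<notin> T t ` F" using t \<open>0 < r\<close> by auto
next
  assume "\<exists>t\<in>{0<..<a}. x \<notin> T t ` F"
  then obtain t where t: "0 < t" "t < a" "x \<notin> T t ` F" by auto
  with \<open>V \<subseteq> F\<close> have "x \<notin> T t ` V" by blast
  then have "gauge_modulus T V x \<le> ennreal t" using gauge_modulus_le[OF sc V] t by blast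
  also have "\<dots> < ennreal a" using t by (simp add: ennreal_less_iff)
  finally show "gauge_modulus T V x < ennreal a" .
qed

text \<open>Continuity is checked for the real-valued version of the gauge, on open rays. The strict
  superlevel sets need \<open>V\<close> open and the strict sublevel sets need \<open>F\<close> closed. The empty intersection
  says that no point lies in all \<open>T\<^sub>t V\<close>, which is finiteness. Baire measurability then
  comes with continuity.\<close>

lemma finite_continuous_modulus_gauge:
  assumes sc: "scaling X T" "space_continuous X T"
    and V: "openin X V" "semicone X T V" "(\<Inter>t\<in>{1<..}. T t ` V) = {}"
    and F: "closedin X F" "V \<subseteq> F" "\<And>s. s \<in> {0<..<1} \<Longrightarrow> F \<subseteq> T s ` V"
  shows "finite_continuous_modulus X T (gauge_modulus T V)"
proof -
  let ?\<tau> = "gauge_modulus T V"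
  have Vsub: "V \<subseteq> topspace X" and Fsub: "F \<subseteq> topspace X"
    using V F by (auto simp: openin_subset closedin_subset)
  have fin: "?\<tau> x < \<infinity>" for x
  proof -
    obtain t where "1 < t" "x \<notin> T t ` V" using V(3) by blast
    then have "?\<tau> x \<le> ennreal t" using gauge_modulus_le[OF sc(1) V(2)] by simp
    also have "\<dots> < \<infinity>" by simp
    finally show ?thesis .
  qed
  have real_eq: "ennreal (enn2real (?\<tau> x)) = ?\<tau> x" for x using fin[of x] by simp
  have lower: "a < enn2real (?\<tau> x) \<longleftrightarrow> (\<exists>t\<in>{a<..}. x \<in> T t ` V)" if "0 \<le> a" for a x
    using less_gauge_modulus_iff[OF that, of T V x] that real_eq[of x]
    by (metis ennreal_less_iff greaterThan_iff)
  have upper: "enn2real (?\<tau> x) < a \<longleftrightarrow> (\<exists>t\<in>{0<..<a}. x \<notin> T t ` F)" if "0 < a" for a x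
    using gauge_modulus_less_iff[OF sc(1) V(2) Fsub F(2,3) that, of x] real_eq[of x]
    by (metis enn2real_nonneg ennreal_less_iff)
  have cont: "continuous_map X euclideanreal (\<lambda>x. enn2real (?\<tau> x))"
    unfolding continuous_map_upper_lower_semicontinuous_lt
  proof (intro allI conjI)
    fix a
    show "openin X {x \<in> topspace X. a < enn2real (?\<tau> x)}"
    proof (cases "0 \<le> a")
      case True
      have "{x \<in> topspace X. a < enn2real (?\<tau> x)} = (\<Union>t\<in>{a<..}. T t ` V)"
        using True sc(1) Vsub by (auto simp: lower scaling_closed subset_eq)
      also have "openin X \<dots>"
        using True by (intro openin_Union) (auto intro!: openin_scaling_image sc V)
      finally show ?thesis .
    next
      case False
      then have "a < enn2real (?\<tau> x)" for x by (meson enn2real_nonneg less_le_trans not_le)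
      then show ?thesis by simp
    qed
    show "openin X {x \<in> topspace X. enn2real (?\<tau> x) < a}"
    proof (cases "0 < a")
      case True
      have "{x \<in> topspace X. enn2real (?\<tau> x) < a} = (\<Union>t\<in>{0<..<a}. topspace X - T t ` F)"
        using True by (auto simp: upper)
      also have "openin X \<dots>"
        by (intro openin_Union) (auto intro!: closedin_scaling_image sc F openin_diff)
      finally show ?thesis .
    next
      case False
      then have "\<not> enn2real (?\<tau> x) < a" for x by (meson enn2real_nonneg less_le_trans not_le)
      then show ?thesis by simp
    qed
  qed
  have "(\<lambda>x. ennreal (enn2real (?\<tau> x))) \<in> borel_measurable (baire X)"
    using continuous_map_measurable_baire[OF cont] by measurable
  moreover have "continuous_map X euclidean (\<lambda>x. ennreal (enn2real (?\<tau> x)))"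
    using cont by (rule continuous_map_ennreal)
  ultimately show ?thesis
    using fin gauge_modulus_scaled[OF sc(1) Vsub]
    by (auto simp: finite_continuous_modulus_def modulus_def real_eq)
qed

text \<open>Up to boundary points \<open>T\<^sub>t V\<close> is the set \<open>{\<tau> > t}\<close>, since \<open>{\<tau> > t} \<subseteq> T\<^sub>t V \<subseteq> {\<tau> \<ge> t}\<close>. Only
  lower bounds of \<open>\<tau>\<close> away from \<open>0\<close> matter for the ideal, so the ambiguity is harmless.\<close>

lemma modulus_ideal_gauge:
  assumes "ideal_on X S" "countable_base S ((\<lambda>n::nat. T (1 / real n) ` V) ` {1..})"
    and sc: "scaling X T" and V: "semicone X T V"
  shows "modulus_ideal X (gauge_modulus T V) = S"
proof (intro set_eqI iffI)
  fix A assume "A \<in> modulus_ideal X (gauge_modulus T V)"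
  then obtain n :: nat where n: "n \<ge> 1" "ennreal (1 / real n) < (INF x\<in>A. gauge_modulus T V x)"
    using positive_ennreal_gt_inverse_nat by (auto simp: modulus_ideal_def)
  have "A \<subseteq> T (1 / real n) ` V"
  proof (rule subsetI, rule ccontr)
    fix x assume "x \<in> A" "x \<notin> T (1 / real n) ` V"
    then have "(INF x\<in>A. gauge_modulus T V x) \<le> ennreal (1 / real n)"
      using gauge_modulus_le[OF sc V, of "1 / real n" x] n by (auto intro: INF_lower2)
    with n show False by simp
  qed
  moreover have "T (1 / real n) ` V \<in> S"
    using assms n by (auto simp: countable_base_def)
  ultimately show "A \<in> S" using assms by (auto simp: ideal_on_def)
next
  fix A assume A: "A \<in> S"
  then obtain n :: nat where n: "n \<ge> 1" "A \<subseteq> T (1 / real n) ` V"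
    using assms by (auto simp: countable_base_def)
  have "0 < ennreal (1 / real n)" using n by simp
  also have "\<dots> \<le> (INF x\<in>A. gauge_modulus T V x)"
    using n by (auto intro!: INF_greatest le_gauge_modulus)
  finally have "0 < (INF x\<in>A. gauge_modulus T V x)" .
  moreover have "A \<subseteq> topspace X" using A assms(1) by (auto simp: ideal_on_def)
  ultimately show "A \<in> modulus_ideal X (gauge_modulus T V)" by (simp add: modulus_ideal_def)
qed

theorem lemma2p3p7:
  fixes X :: "'a topology" and T :: "real \<Rightarrow> 'a \<Rightarrow> 'a" and S :: "'a set set"
  assumes "scaling X T"
    and "ideal_on X S"
  shows "((\<exists>\<tau>. finite_continuous_modulus X T \<tau> \<and> S = modulus_ideal X \<tau>) \<longrightarrow> condition_B X T S) \<and>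
    (space_continuous X T \<and> condition_B X T S \<longrightarrow>
       (\<exists>\<tau>. finite_continuous_modulus X T \<tau> \<and> S = modulus_ideal X \<tau>))"
proof (intro conjI impI)
  assume "\<exists>\<tau>. finite_continuous_modulus X T \<tau> \<and> S = modulus_ideal X \<tau>"
  then obtain \<tau> where "finite_continuous_modulus X T \<tau>" "S = modulus_ideal X \<tau>" by blast
  then show "condition_B X T S"
    using condition_B_modulus_ideal[OF assms(1)] by simp
next
  assume asm: "space_continuous X T \<and> condition_B X T S"
  then have sc: "space_continuous X T" by (rule conjunct1)
  obtain V F
    where V: "functionally_open X V" "semicone X T V"
      "countable_base S ((\<lambda>n::nat. T (1 / real n) ` V) ` {1..})" "(\<Inter>t\<in>{1<..}. T t ` V) = {}"
    and F: "functionally_closed X F" "V \<subseteq> F" "\<And>s. s \<in> {0<..<1} \<Longrightarrow> F \<subseteq> T s ` V"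
    using asm[THEN conjunct2, unfolded condition_B_def] by (elim exE conjE) (blast intro!: that)
  have "finite_continuous_modulus X T (gauge_modulus T V)"
    by (rule finite_continuous_modulus_gauge[OF assms(1) sc functionally_open_imp_openin[OF V(1)]
          V(2,4) functionally_closed_imp_closedin[OF F(1)] F(2,3)])
  with modulus_ideal_gauge[OF assms(2) V(3) assms(1) V(2)]
  show "\<exists>\<tau>. finite_continuous_modulus X T \<tau> \<and> S = modulus_ideal X \<tau>" by blast
qed

end
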